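(* Let $q$ be a prime power and $d\geq0$ an integer. The average number of periodic points in $\mathbb{P}^1(\mathbb{F}_q)$ of rational functions of degree $d$ on $\mathbb{P}^1(\mathbb{F}_q)$ is at least \[ \sum_{k=1}^{\min\{d,q\}}\left(\frac{(q+1)q\cdots(q+1-(k-1))}{q^k}\right)\left(1-\frac{k+4}{q}\right). \] In particular, the average number of periodic points of degree $d$ rational functions on $\mathbb{P}^1(\mathbb{F}_q)$ is at least $\frac{5}{6}\min\{d,\lfloor\sqrt{q}\rfloor\}-3$.
   Context: A rational function on $\mathbb{P}^1(\mathbb{F}_q)$ is an element of $\mathbb{F}_q(x)$ or the constant function $\infty$; all constant functions, including the constant $\infty$, have degree $0$, and otherwise the degree of $f/g$ with $f,g\in\mathbb{F}_q[x]$ coprime is $\max\{\deg f,\deg g\}$. A point $\alpha\in\mathbb{P}^1(\mathbb{F}_q)$ is periodic for $f$ if $f^{n}(\alpha)=\alpha$ for some $n\geq1$, where $f^n$ is the $n$-fold iterate of the map $f:\mathbb{P}^1(\mathbb{F}_q)\to\mathbb{P}^1(\mathbb{F}_q)$. The average is taken uniformly over all rational functions on $\mathbb{P}^1(\mathbb{F}_q)$ of degree exactly $d$. In the displayed sum, the product $(q+1)q\cdots(q+1-(k-1))$ is $\prod_{j=0}^{k-1}(q+1-j)$, and empty sums are $0$. *)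

theory Defs
  imports Complex_Main "HOL-Library.Cardinality" "HOL-Computational_Algebra.Fraction_Field" "HOL-Computational_Algebra.Polynomial"
begin

text \<open>In both types below, \<open>None\<close> stands for infinity: the point at infinity of the projective
  line, respectively the constant function infinity, which is not an element of the function field.\<close>

type_synonym 'a proj_line = "'a option"

type_synonym 'a rat_fun = "'a poly fract option"

text \<open>The representation of an element of the function field in lowest terms, made unique by
  requiring a monic denominator.\<close>

definition lowest_terms :: "'a::field poly fract \<Rightarrow> 'a poly \<times> 'a poly" where
  "lowest_terms r = (THE (f, g). r = Fraction_Field.Fract f g \<and> coprime f g \<and> lead_coeff g = 1)"

lemma lowest_terms_ex1:
  fixes r :: "'a::field poly fract"
  shows "\<exists>!p. case p of (f,g) \<Rightarrow> r = Fraction_Field.Fract f g \<and> coprime f g \<and> lead_coeff g = 1"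
proof -
  define P where "P = (\<lambda>n. \<exists>f g. g \<noteq> 0 \<and> r = Fraction_Field.Fract f g \<and> degree g = n)"
  obtain f0 g0 where "r = Fraction_Field.Fract f0 g0" "g0 \<noteq> 0" by (cases r) auto
  hence "P (degree g0)" unfolding P_def by blast
  hence L: "P (LEAST n. P n)" by (rule LeastI)
  then obtain f g where fg: "g \<noteq> 0" "r = Fraction_Field.Fract f g" "degree g = (LEAST n. P n)"
    unfolding P_def by blast
  have min: "degree g \<le> degree g'" if "g' \<noteq> 0" "r = Fraction_Field.Fract f' g'" for f' g'
    unfolding fg(3) by (rule Least_le) (use that P_def in blast)
  have cop: "coprime f g"
  proof (rule coprimeI)
    fix c assume "c dvd f" "c dvd g"
    then obtain a b where ab: "f = c * a" "g = c * b" by (auto elim!: dvdE)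
    have nz: "c \<noteq> 0" "b \<noteq> 0" using fg ab by auto
    have "r = Fraction_Field.Fract a b" using fg ab nz by (simp add: eq_fract)
    from min[OF nz(2) this] have "degree c = 0" using ab nz by (simp add: degree_mult_eq)
    thus "is_unit c" using nz is_unit_iff_degree by blast
  qed
  define u where "u = inverse (lead_coeff g)"
  have u: "u \<noteq> 0" "u * lead_coeff g = 1" using fg(1) by (simp_all add: u_def)
  have ex: "r = Fraction_Field.Fract (smult u f) (smult u g) \<and> coprime (smult u f) (smult u g)
      \<and> lead_coeff (smult u g) = 1"
  proof (intro conjI)
    show "r = Fraction_Field.Fract (smult u f) (smult u g)"
      using fg(1,2) u(1) by (simp add: eq_fract)
    show "coprime (smult u f) (smult u g)"
      using cop u(1) unfolding coprime_def by (simp add: dvd_smult_iff)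
    show "lead_coeff (smult u g) = 1" using u(2) by (simp only: lead_coeff_smult)
  qed
  have uniq: "p = (smult u f, smult u g)" if "case p of (f,g) \<Rightarrow> r = Fraction_Field.Fract f g \<and> coprime f g \<and> lead_coeff g = 1" for p
  proof -
    obtain f' g' where p: "p = (f', g')" by (cases p)
    have h: "r = Fraction_Field.Fract f' g'" "coprime f' g'" "lead_coeff g' = 1"
      using that p by auto
    have nz: "g' \<noteq> 0" using h by auto
    have e: "f' * g = f * g'" using h(1) nz fg eq_fract(1)[of g' g f' f] by simp
    define q where "q = g' div g"
    have q: "g' = q * g + g' mod g" by (simp add: q_def)
    have e': "(f' - q * f) * g = f * (g' mod g)"
      using e q by (simp add: algebra_simps) (metis distrib_left mult.assoc mult.commute add_left_cancel)
    have "g' mod g = 0"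
    proof (rule ccontr)
      assume m: "g' mod g \<noteq> 0"
      have "r = Fraction_Field.Fract (f' - q * f) (g' mod g)"
        using e' m fg(1,2) eq_fract(1)[of g "g' mod g" f "f' - q * f"] by simp
      from min[OF m this] show False using degree_mod_less'[OF fg(1) m] by simp
    qed
    then have q': "g' = q * g" "f' = q * f" using q e' fg(1) by simp_all
    then have "is_unit q" using h(2) by (meson coprime_common_divisor dvd_triv_left)
    then obtain c where c: "q = [:c:]" by (auto elim: is_unit_polyE)
    have "c * lead_coeff g = 1" using h(3) unfolding q' c by (simp split: if_splits)
    then have "c = u" using u(2) fg(1) by (metis leading_coeff_0_iff mult_right_cancel)
    then show ?thesis using p q' c by simp
  qed
  show ?thesis using ex uniq by (intro ex1I[of _ "(smult u f, smult u g)"]) auto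
qed

definition rat_degree :: "'a::field rat_fun \<Rightarrow> nat" where
  "rat_degree r = (case r of
      None \<Rightarrow> 0
    | Some s \<Rightarrow> (case lowest_terms s of (f, g) \<Rightarrow> max (degree f) (degree g)))"

text \<open>With \<open>n = max (degree f) (degree g)\<close>, the map induced by \<open>f / g\<close> is \<open>[X : Y] \<mapsto> [F : G]\<close> for the
  degree \<open>n\<close> homogenizations \<open>F\<close>, \<open>G\<close> of \<open>f\<close>, \<open>g\<close>. At infinity, i.e. \<open>[1 : 0]\<close>, these take the values
  \<open>coeff f n\<close> and \<open>coeff g n\<close>, which are not both zero.\<close>

definition proj_quot :: "'a::field \<Rightarrow> 'a \<Rightarrow> 'a proj_line" where
  "proj_quot a b = (if b = 0 then None else Some (a / b))"

definition rat_map :: "'a::field rat_fun \<Rightarrow> 'a proj_line \<Rightarrow> 'a proj_line" where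
  "rat_map r P = (case r of
      None \<Rightarrow> None
    | Some s \<Rightarrow> (case lowest_terms s of (f, g) \<Rightarrow>
        (case P of
           Some x \<Rightarrow> proj_quot (poly f x) (poly g x)
         | None \<Rightarrow> (let n = max (degree f) (degree g) in proj_quot (coeff f n) (coeff g n)))))"

definition periodic_points :: "('b \<Rightarrow> 'b) \<Rightarrow> 'b set" where
  "periodic_points h = {P. \<exists>n\<ge>1. (h ^^ n) P = P}"

definition rat_funs_of_degree :: "nat \<Rightarrow> 'a::field rat_fun set" where
  "rat_funs_of_degree d = {r. rat_degree r = d}"

definition average :: "('b \<Rightarrow> real) \<Rightarrow> 'b set \<Rightarrow> real" where
  "average h A = (\<Sum>x\<in>A. h x) / real (card A)"

end

theory Submission
  imports Defs "HOL-Library.Product_Plus" "HOL-Library.FuncSet"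
begin

text \<open>A cycle of length \<open>k\<close> prescribes the values of the function at \<open>k\<close> points, so it suffices to
  show that a random function of degree \<open>d\<close> takes prescribed values on a set \<open>S\<close> of \<open>k \<le> min d q\<close>
  points with probability at least \<open>(1 - (k + 4) / q) / q ^ k\<close>. Pairs of forms of degree \<open>d\<close>
  satisfying the \<open>k\<close> corresponding linear conditions number at least \<open>q ^ (2 * d + 2 - k)\<close>, and all but a
  proportion \<open>(k + 4) / q\<close> of these are coprime: at most \<open>k / q\<close> have a common zero on \<open>S\<close>, at most
  \<open>1 / q\<close> are proportional to a fixed nonzero solution \<open>w\<close> of least degree, and any other pair that is
  not coprime is \<open>H * v\<close> with \<open>deg H = e \<ge> 1\<close> and \<open>v\<close> a solution of degree \<open>d - e\<close> that is not
  proportional to \<open>w\<close>. As the determinant of \<open>v\<close> and \<open>w\<close> vanishes on \<open>S\<close>, there are at most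
  \<open>q ^ (2 * (d - e) + 2 - k)\<close> such \<open>v\<close>, even when \<open>d - e\<close> is too small for the \<open>k\<close> conditions to be
  independent. Summing over \<open>H\<close> loses a further \<open>3 / q\<close>.\<close>

section \<open>Binary forms as polynomials of bounded degree\<close>

text \<open>A binary form of degree \<open>m\<close> is stored as its dehomogenization, a polynomial of degree at
  most \<open>m\<close>; its value at infinity is the coefficient of index \<open>m\<close>.\<close>

definition forms :: "nat \<Rightarrow> 'a::field poly set" where
  "forms m = {F. degree F \<le> m}"

definition form_eval :: "nat \<Rightarrow> 'a::field poly \<Rightarrow> 'a proj_line \<Rightarrow> 'a" where
  "form_eval m F P = (case P of None \<Rightarrow> coeff F m | Some x \<Rightarrow> poly F x)"

text \<open>The linear form with \<open>P\<close> as its zero. At infinity this is the form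
  \<open>Y\<close>, which dehomogenizes to 1.\<close>

definition point_form :: "'a::field proj_line \<Rightarrow> 'a poly" where
  "point_form P = (case P of None \<Rightarrow> 1 | Some x \<Rightarrow> [:- x, 1:])"

lemma form_eval_0 [simp]: "form_eval m 0 P = 0"
  by (auto simp: form_eval_def split: option.splits)

lemma form_eval_diff: "form_eval m (F - G) P = form_eval m F P - form_eval m G P"
  by (auto simp: form_eval_def split: option.splits)

lemma form_eval_smult: "form_eval m (smult c F) P = c * form_eval m F P"
  by (auto simp: form_eval_def split: option.splits)

lemma forms_0 [simp]: "0 \<in> forms m"
  by (simp add: forms_def)

lemma forms_diff: "F \<in> forms m \<Longrightarrow> G \<in> forms m \<Longrightarrow> F - G \<in> forms m"
  by (auto simp: forms_def intro: degree_diff_le)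

lemma forms_mult: "F \<in> forms m \<Longrightarrow> G \<in> forms n \<Longrightarrow> F * G \<in> forms (m + n)"
  unfolding forms_def using degree_mult_le[of F G] by auto

lemma form_eval_mult:
  assumes "F \<in> forms m" "G \<in> forms n"
  shows "form_eval (m + n) (F * G) P = form_eval m F P * form_eval n G P"
proof (cases P)
  case None
  have "coeff (F * G) (m + n) = (\<Sum>i\<le>m+n. coeff F i * coeff G (m + n - i))"
    by (simp add: coeff_mult)
  also have "\<dots> = (\<Sum>i\<in>{m}. coeff F i * coeff G (m + n - i))"
  proof (rule sum.mono_neutral_right)
    show "\<forall>i\<in>{..m + n} - {m}. coeff F i * coeff G (m + n - i) = 0"
    proof
      fix i assume "i \<in> {..m + n} - {m}"
      then have "i > m \<or> m + n - i > n" by auto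
      then show "coeff F i * coeff G (m + n - i) = 0"
        using assms by (auto simp: forms_def coeff_eq_0)
    qed
  qed auto
  finally show ?thesis using None by (simp add: form_eval_def)
qed (simp add: form_eval_def)

lemma point_form_in_forms: "point_form P \<in> forms 1"
  by (auto simp: point_form_def forms_def split: option.splits)

lemma point_form_nonzero [simp]: "point_form P \<noteq> 0"
  by (auto simp: point_form_def split: option.splits)

lemma form_eval_point_form: "form_eval 1 (point_form P) Q = 0 \<longleftrightarrow> P = Q"
  by (auto simp: point_form_def form_eval_def split: option.splits)

lemma form_eval_point_form_mult:
  assumes "F \<in> forms m"
  shows "form_eval (Suc m) (point_form P * F) Q = form_eval 1 (point_form P) Q * form_eval m F Q"
  using form_eval_mult[OF point_form_in_forms assms, of P Q] by simp

text \<open>At infinity the vanishing top coefficient lets the same polynomial count as a form of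
  degree \<open>m\<close>: the factor \<open>Y\<close> split off is the polynomial 1.\<close>

lemma form_root_factor:
  assumes "F \<in> forms (Suc m)" "form_eval (Suc m) F P = 0"
  obtains F' where "F' \<in> forms m" "F = point_form P * F'"
proof (cases P)
  case None
  then have c: "coeff F (Suc m) = 0" using assms by (simp add: form_eval_def)
  have "degree F \<le> m"
  proof (rule degree_le, intro allI impI)
    fix i assume "m < i"
    then show "coeff F i = 0"
      using c assms(1) by (cases "i = Suc m") (auto simp: forms_def coeff_eq_0)
  qed
  then show ?thesis using that[of F] None by (simp add: forms_def point_form_def)
next
  case (Some x)
  then have "[:- x, 1:] dvd F" using assms by (simp add: form_eval_def poly_eq_0_iff_dvd)
  then obtain F' where F': "F = [:- x, 1:] * F'" by blast
  have "degree F' \<le> m"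
  proof (cases "F' = 0")
    case False
    then have "degree F = 1 + degree F'" unfolding F' by (subst degree_mult_eq) auto
    then show ?thesis using assms(1) by (simp add: forms_def)
  qed simp
  then show ?thesis using that[of F'] F' Some by (simp add: forms_def point_form_def)
qed

lemma form_of_degree_0_root:
  assumes "F \<in> forms 0" "form_eval 0 F P = 0"
  shows "F = 0"
proof -
  have "degree F = 0" using assms(1) by (simp add: forms_def)
  then obtain c where "F = [:c:]" by (rule degree_eq_zeroE)
  then show ?thesis using assms(2) by (auto simp: form_eval_def split: option.splits)
qed

section \<open>Counting forms\<close>

lemma forms_Suc: "(forms (Suc m) :: 'a::field poly set) = (\<lambda>(a, p). pCons a p) ` (UNIV \<times> forms m)"
    (is "?L = ?R")
proof
  show "?L \<subseteq> ?R"
  proof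
    fix F :: "'a poly" assume F: "F \<in> forms (Suc m)"
    obtain a p where "F = pCons a p" by (cases F)
    with F show "F \<in> ?R"
      by (intro image_eqI[of _ _ "(a, p)"]) (auto simp: forms_def split: if_splits)
  qed
qed (auto simp: forms_def)

lemma card_forms:
  "finite (forms m :: 'a::{field,finite} poly set) \<and> card (forms m :: 'a poly set) = CARD('a) ^ Suc m"
proof (induction m)
  case 0
  have "(forms 0 :: 'a poly set) = range (\<lambda>c. [:c:])"
    by (auto simp: forms_def elim: degree_eq_zeroE)
  moreover have "inj (\<lambda>c::'a. [:c:])" by (auto intro: injI)
  ultimately show ?case by (simp add: card_image)
next
  case (Suc m)
  have "inj_on (\<lambda>(a, p). pCons a p) (UNIV \<times> (forms m :: 'a poly set))"
    by (auto intro: inj_onI)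
  then show ?case using Suc by (simp add: forms_Suc card_image card_cartesian_product)
qed

lemma finite_forms [simp]: "finite (forms m :: 'a::{field,finite} poly set)"
  using card_forms by blast

text \<open>Representatives of the nonzero forms up to scalars; a degree below \<open>e\<close>
  corresponds to zeros at infinity.\<close>

definition monic_forms :: "nat \<Rightarrow> 'a::field poly set" where
  "monic_forms e = {H. degree H \<le> e \<and> lead_coeff H = 1}"

lemma finite_monic_forms [simp]: "finite (monic_forms e :: 'a::{field,finite} poly set)"
  by (rule finite_subset[OF _ finite_forms[of e]]) (auto simp: monic_forms_def forms_def)

lemma CARD_field_ge_2: "CARD('a::{field,finite}) \<ge> 2"
proof -
  have "card {0, 1 :: 'a} \<le> CARD('a)" by (rule card_mono) auto
  then show ?thesis by simp
qed

text \<open>The number N(e) satisfies N(e + 1) \<le> 1 + q * N(e). The added 1 in the statement,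
  together with q \<ge> 2, lets the induction close.\<close>

lemma card_monic_forms: "card (monic_forms e :: 'a::{field,finite} poly set) + 1 \<le> 2 * CARD('a) ^ e"
proof (induction e)
  case 0
  have "(monic_forms 0 :: 'a poly set) = {1}"
    by (auto simp: monic_forms_def elim!: degree_eq_zeroE)
  then show ?case by simp
next
  case (Suc e)
  let ?q = "CARD('a)"
  let ?f = "\<lambda>(a, p). pCons a (p :: 'a poly)"
  have "monic_forms (Suc e) \<subseteq> insert 1 (?f ` (UNIV \<times> monic_forms e))"
  proof
    fix F :: "'a poly" assume F: "F \<in> monic_forms (Suc e)"
    obtain a p where Fp: "F = pCons a p" by (cases F)
    show "F \<in> insert 1 (?f ` (UNIV \<times> monic_forms e))"
    proof (cases "p = 0")
      case True
      then show ?thesis using F Fp by (auto simp: monic_forms_def)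
    next
      case False
      then have "p \<in> monic_forms e" using F Fp by (auto simp: monic_forms_def)
      then show ?thesis using Fp by auto
    qed
  qed
  then have "card (monic_forms (Suc e) :: 'a poly set) \<le> card (insert 1 (?f ` (UNIV \<times> monic_forms e)))"
    by (intro card_mono) auto
  also have "\<dots> \<le> Suc (card (?f ` (UNIV \<times> monic_forms e)))" by (rule card_insert_le_m1) auto
  also have "card (?f ` (UNIV \<times> monic_forms e)) \<le> card ((UNIV :: 'a set) \<times> (monic_forms e :: 'a poly set))"
    by (rule card_image_le) auto
  also have "\<dots> = ?q * card (monic_forms e :: 'a poly set)" by (simp add: card_cartesian_product)
  finally have "card (monic_forms (Suc e) :: 'a poly set) \<le> Suc (?q * card (monic_forms e :: 'a poly set))"
    by simp
  moreover have "?q * (card (monic_forms e :: 'a poly set) + 1) \<le> ?q * (2 * ?q ^ e)"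
    using Suc by (rule mult_le_mono2)
  ultimately show ?case using CARD_field_ge_2[where 'a='a] by (simp add: algebra_simps)
qed

text \<open>A counting form of rank-nullity: subtracting a fixed element embeds each nonempty fibre
  of \<open>f\<close> into \<open>K\<close>.\<close>

lemma card_le_kernel_times_range:
  fixes f :: "'b::ab_group_add \<Rightarrow> 'c"
  assumes "finite B" "finite K" "f ` A \<subseteq> B"
    and ker: "\<And>x y. x \<in> A \<Longrightarrow> y \<in> A \<Longrightarrow> f x = f y \<Longrightarrow> x - y \<in> K"
  shows "card A \<le> card B * card K"
proof -
  have fib: "finite {x \<in> A. f x = z} \<and> card {x \<in> A. f x = z} \<le> card K" for z
  proof (cases "{x \<in> A. f x = z} = {}")
    case True
    show ?thesis unfolding True by simp
  next
    case False
    then obtain y where y: "y \<in> A" "f y = z" by blast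
    have sub: "(\<lambda>x. x - y) ` {x \<in> A. f x = z} \<subseteq> K" using ker y by auto
    have inj: "inj_on (\<lambda>x. x - y) {x \<in> A. f x = z}" by (auto intro: inj_onI)
    show ?thesis
      using inj_on_finite[OF inj sub assms(2)] card_inj_on_le[OF inj sub assms(2)] by blast
  qed
  have "A \<subseteq> (\<Union>z\<in>B. {x \<in> A. f x = z})" using assms(3) by auto
  then have "card A \<le> card (\<Union>z\<in>B. {x \<in> A. f x = z})"
    using fib assms(1) by (intro card_mono) auto
  also have "\<dots> \<le> (\<Sum>z\<in>B. card {x \<in> A. f x = z})" by (rule card_UN_le) (rule assms)
  also have "\<dots> \<le> (\<Sum>z\<in>B. card K)" using fib by (intro sum_mono) auto
  finally show ?thesis by simp
qed

section \<open>Forms vanishing at prescribed points\<close>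

definition vanishing_forms :: "nat \<Rightarrow> 'a::field proj_line set \<Rightarrow> 'a poly set" where
  "vanishing_forms m S = {F \<in> forms m. \<forall>P\<in>S. form_eval m F P = 0}"

lemma finite_vanishing_forms [simp]:
  "finite (vanishing_forms m S :: 'a::{field,finite} poly set)"
  by (rule finite_subset[OF _ finite_forms[of m]]) (auto simp: vanishing_forms_def)

text \<open>Each point of \<open>S\<close> costs one dimension: dividing by its point form lowers
  \<open>m\<close> and \<open>card S\<close> together, and the other zeros survive because the point
  form vanishes nowhere else.\<close>

lemma card_vanishing_forms:
  fixes S :: "'a::{field,finite} proj_line set"
  assumes "card S \<le> Suc m"
  shows "card (vanishing_forms m S) * CARD('a) ^ card S \<le> CARD('a) ^ Suc m"
proof -
  have "finite S" by simp
  then show ?thesis using assms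
  proof (induction S arbitrary: m rule: finite_induct)
    case empty
    then show ?case using card_forms[where 'a='a] by (simp add: vanishing_forms_def)
  next
    case (insert P S)
    show ?case
    proof (cases m)
      case 0
      then have "S = {}" using insert by simp
      moreover have "vanishing_forms 0 {P} \<subseteq> {0}"
        using form_of_degree_0_root by (auto simp: vanishing_forms_def)
      then have "card (vanishing_forms 0 {P}) \<le> card {0 :: 'a poly}" by (intro card_mono) auto
      ultimately show ?thesis using 0 by simp
    next
      case (Suc m')
      have "vanishing_forms m (insert P S) \<subseteq> (*) (point_form P) ` vanishing_forms m' S"
      proof
        fix F assume F: "F \<in> vanishing_forms m (insert P S)"
        then obtain F' where F': "F' \<in> forms m'" "F = point_form P * F'"
          using form_root_factor[of F m' P] Suc by (auto simp: vanishing_forms_def)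
        have "form_eval m' F' Q = 0" if "Q \<in> S" for Q
        proof -
          have "form_eval 1 (point_form P) Q * form_eval m' F' Q = 0"
            using F that Suc form_eval_point_form_mult[OF F'(1), of P Q] F'(2)
            by (simp add: vanishing_forms_def)
          moreover have "P \<noteq> Q" using insert that by auto
          ultimately show ?thesis using form_eval_point_form[of P Q] by auto
        qed
        then show "F \<in> (*) (point_form P) ` vanishing_forms m' S"
          using F' by (auto simp: vanishing_forms_def)
      qed
      then have "card (vanishing_forms m (insert P S)) \<le> card (vanishing_forms m' S)"
        by (meson card_image_le card_mono finite_imageI finite_vanishing_forms le_trans)
      then have "card (vanishing_forms m (insert P S)) * CARD('a) ^ card S \<le> CARD('a) ^ Suc m'"
        using insert.IH[of m'] insert.prems insert.hyps Suc
        by (metis Suc_le_mono card_insert_disjoint le_trans mult_le_mono1)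
      then show ?thesis using insert.hyps Suc by (simp add: algebra_simps)
    qed
  qed
qed

text \<open>For \<open>Suc m\<close> of the points the preceding count leaves room for a single
  form, which is 0.\<close>

lemma form_many_roots:
  fixes S :: "'a::{field,finite} proj_line set"
  assumes "F \<in> vanishing_forms m S" "m < card S"
  shows "F = 0"
proof -
  obtain T where T: "T \<subseteq> S" "card T = Suc m"
    using assms(2) obtain_subset_with_card_n[of "Suc m" S] by (metis Suc_leI)
  have "card (vanishing_forms m T) * CARD('a) ^ Suc m \<le> CARD('a) ^ Suc m"
    using card_vanishing_forms[of T m] T by simp
  then have "card (vanishing_forms m T) \<le> 1" by simp
  moreover have "F \<in> vanishing_forms m T" "0 \<in> vanishing_forms m T"
    using assms(1) T by (auto simp: vanishing_forms_def)
  ultimately show ?thesis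
    using card_le_Suc0_iff_eq[of "vanishing_forms m T"] by auto
qed

section \<open>Pairs of forms with prescribed values\<close>

text \<open>A linear form in \<open>(u, v)\<close> whose kernel is the line that \<open>B\<close>
  stands for: infinity is [1 : 0] and \<open>Some y\<close> is [y : 1].\<close>

definition lin_cond :: "'a::field proj_line \<Rightarrow> 'a \<Rightarrow> 'a \<Rightarrow> 'a" where
  "lin_cond B u v = (case B of None \<Rightarrow> v | Some y \<Rightarrow> u - y * v)"

text \<open>A pair of forms without common zero on \<open>S\<close> lies in \<open>match_pairs d S b\<close> iff the map it
  induces agrees with \<open>b\<close> on \<open>S\<close>; common zeros on \<open>S\<close> are allowed in order to have a vector space.\<close>

definition match_pairs ::
    "nat \<Rightarrow> 'a::field proj_line set \<Rightarrow> ('a proj_line \<Rightarrow> 'a proj_line) \<Rightarrow> ('a poly \<times> 'a poly) set" where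
  "match_pairs d S b = {v. fst v \<in> forms d \<and> snd v \<in> forms d \<and>
     (\<forall>P\<in>S. lin_cond (b P) (form_eval d (fst v) P) (form_eval d (snd v) P) = 0)}"

text \<open>For nonzero \<open>w\<close> it vanishes iff \<open>v\<close> is proportional to
  \<open>w\<close> over the function field. It is linear in \<open>v\<close>, so it reduces counting
  pairs to counting single forms.\<close>

definition det :: "'a::field poly \<times> 'a poly \<Rightarrow> 'a poly \<times> 'a poly \<Rightarrow> 'a poly" where
  "det w v = fst v * snd w - snd v * fst w"

lemma lin_cond_0 [simp]: "lin_cond B 0 0 = 0"
  by (simp add: lin_cond_def split: option.splits)

lemma lin_cond_diff: "lin_cond B (u - u') (v - v') = lin_cond B u v - lin_cond B u' v'"
  by (simp add: lin_cond_def algebra_simps split: option.splits)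

lemma lin_cond_mult: "lin_cond B (c * u) (c * v) = c * lin_cond B u v"
  by (simp add: lin_cond_def algebra_simps split: option.splits)

text \<open>Both vectors lie on the line given by \<open>B\<close>, so their determinant
  vanishes.\<close>

lemma lin_cond_parallel:
  "lin_cond B u v = 0 \<Longrightarrow> lin_cond B u' v' = 0 \<Longrightarrow> u * v' - v * u' = 0"
  by (auto simp: lin_cond_def split: option.splits)

lemma proj_quot_eq:
  "lin_cond B u v = 0 \<Longrightarrow> u \<noteq> 0 \<or> v \<noteq> 0 \<Longrightarrow> proj_quot u v = B"
  by (auto simp: lin_cond_def proj_quot_def split: option.splits)

lemma match_pairs_0 [simp]: "0 \<in> match_pairs d S b"
  by (simp add: match_pairs_def)

lemma match_pairs_diff: "v \<in> match_pairs d S b \<Longrightarrow> w \<in> match_pairs d S b \<Longrightarrow> v - w \<in> match_pairs d S b"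
  by (simp add: match_pairs_def forms_diff form_eval_diff lin_cond_diff)

text \<open>By \<open>lin_cond_mult\<close>, the factor \<open>H\<close> only multiplies the
  condition at \<open>P\<close> by its nonzero value there.\<close>

lemma match_pairs_cancel:
  assumes "H \<in> forms e" "F \<in> forms m" "G \<in> forms m"
    and "(H * F, H * G) \<in> match_pairs (e + m) S b"
    and "\<And>P. P \<in> S \<Longrightarrow> form_eval e H P \<noteq> 0"
  shows "(F, G) \<in> match_pairs m S b"
  using assms by (auto simp: match_pairs_def form_eval_mult lin_cond_mult)

lemma finite_match_pairs [simp]:
  "finite (match_pairs d S b :: ('a::{field,finite} poly \<times> 'a poly) set)"
  by (rule finite_subset[of _ "forms d \<times> forms d"]) (auto simp: match_pairs_def)

text \<open>The space of pairs has dimension 2 * d + 2 and is cut by \<open>card S\<close> linear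
  conditions.\<close>

lemma card_match_pairs_ge:
  fixes S :: "'a::{field,finite} proj_line set"
  shows "CARD('a) ^ (2 * d + 2) \<le> card (match_pairs d S b) * CARD('a) ^ card S"
proof -
  let ?f = "\<lambda>v. \<lambda>P\<in>S. lin_cond (b P) (form_eval d (fst v) P) (form_eval d (snd v) P)"
  have "card (forms d \<times> forms d :: ('a poly \<times> 'a poly) set)
      \<le> card (PiE S (\<lambda>_. UNIV :: 'a set)) * card (match_pairs d S b)"
  proof (rule card_le_kernel_times_range[where f = ?f])
    fix v w assume vw: "v \<in> forms d \<times> forms d" "w \<in> forms d \<times> forms d" "?f v = ?f w"
    have "lin_cond (b P) (form_eval d (fst v) P) (form_eval d (snd v) P) =
          lin_cond (b P) (form_eval d (fst w) P) (form_eval d (snd w) P)" if "P \<in> S" for P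
      using fun_cong[OF vw(3), of P] that by simp
    then show "v - w \<in> match_pairs d S b"
      using vw(1,2) by (auto simp: match_pairs_def forms_diff form_eval_diff lin_cond_diff)
  qed (auto intro: finite_PiE)
  then have "CARD('a) ^ Suc d * CARD('a) ^ Suc d \<le> card (match_pairs d S b) * CARD('a) ^ card S"
    using card_forms[where 'a='a and m=d]
    by (simp add: card_cartesian_product card_PiE mult.commute)
  moreover have "CARD('a) ^ Suc d * CARD('a) ^ Suc d = CARD('a) ^ (2 * d + 2)"
    by (simp flip: power_add add: mult_2 del: power_Suc)
  ultimately show ?thesis by (simp only:)
qed

definition common_zero_pairs ::
    "nat \<Rightarrow> 'a::field proj_line set \<Rightarrow> ('a proj_line \<Rightarrow> 'a proj_line) \<Rightarrow> 'a proj_line \<Rightarrow> ('a poly \<times> 'a poly) set" where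
  "common_zero_pairs d S b P =
     {v \<in> match_pairs d S b. form_eval d (fst v) P = 0 \<and> form_eval d (snd v) P = 0}"

text \<open>At each point of \<open>S\<close> other than \<open>P\<close> the matching condition
  leaves one free value, and if all these values are 0 then both forms vanish on \<open>S\<close>.
  With k = \<open>card S\<close> this gives q^(k - 1) * q^(2 * (d + 1 - k)).\<close>

lemma card_common_zero_pairs:
  fixes S :: "'a::{field,finite} proj_line set"
  assumes "P \<in> S" "card S \<le> Suc d"
  shows "card (common_zero_pairs d S b P) * CARD('a) ^ card S \<le> CARD('a) ^ (2 * d + 1)"
proof -
  let ?q = "CARD('a)" and ?k = "card S"
  let ?Z = "vanishing_forms d S"
  \<comment> \<open>A coordinate on the line cut out by the condition at \<open>Q\<close>: when it
    is 0, both values at \<open>Q\<close> are 0.\<close>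
  let ?t = "\<lambda>v Q. if b Q = None then form_eval d (fst v) Q else form_eval d (snd v) Q"
  let ?f = "\<lambda>v. \<lambda>Q\<in>S - {P}. ?t v Q"
  have "card (common_zero_pairs d S b P)
      \<le> card (PiE (S - {P}) (\<lambda>_. UNIV :: 'a set)) * card (?Z \<times> ?Z)"
  proof (rule card_le_kernel_times_range[where f = ?f])
    fix v w assume vw: "v \<in> common_zero_pairs d S b P" "w \<in> common_zero_pairs d S b P" "?f v = ?f w"
    define x where "x = v - w"
    have x: "x \<in> match_pairs d S b" using vw match_pairs_diff
      unfolding x_def common_zero_pairs_def by blast
    have "form_eval d (fst x) Q = 0 \<and> form_eval d (snd x) Q = 0" if "Q \<in> S" for Q
    proof (cases "Q = P")
      case True
      then show ?thesis using vw by (simp add: x_def common_zero_pairs_def form_eval_diff)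
    next
      case False
      then have t: "?t v Q = ?t w Q" using fun_cong[OF vw(3), of Q] that by simp
      have l: "lin_cond (b Q) (form_eval d (fst x) Q) (form_eval d (snd x) Q) = 0"
        using x that by (simp add: match_pairs_def)
      show ?thesis
      proof (cases "b Q")
        case None
        then show ?thesis using t l by (simp add: lin_cond_def x_def form_eval_diff)
      next
        case (Some y)
        then have "form_eval d (snd x) Q = 0" using t by (simp add: x_def form_eval_diff)
        then show ?thesis using l Some by (simp add: lin_cond_def)
      qed
    qed
    then show "v - w \<in> ?Z \<times> ?Z"
      using x by (auto simp: match_pairs_def vanishing_forms_def mem_Times_iff x_def)
  next
    show "?f ` common_zero_pairs d S b P \<subseteq> PiE (S - {P}) (\<lambda>_. UNIV)"
      by (intro image_subsetI) (simp only: restrict_PiE_iff, simp)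
  qed (auto intro: finite_PiE)
  then have c: "card (common_zero_pairs d S b P) \<le> ?q ^ (?k - 1) * (card ?Z * card ?Z)"
    using assms(1) by (simp add: card_PiE card_cartesian_product)
  have k: "?q ^ ?k = ?q * ?q ^ (?k - 1)"
    using assms(1) by (metis card_gt_0_iff empty_iff finite power_eq_if less_numeral_extra(3))
  \<comment> \<open>The extra factor q completes q^(k - 1) * q^k to q^k * q^k, one power for each of
    the two vanishing forms.\<close>
  have "(card (common_zero_pairs d S b P) * ?q ^ ?k) * ?q
      \<le> (?q ^ (?k - 1) * (card ?Z * card ?Z)) * ?q ^ ?k * ?q"
    using c by (intro mult_le_mono) auto
  also have "\<dots> = (card ?Z * ?q ^ ?k) * (card ?Z * ?q ^ ?k)" unfolding k by (simp add: algebra_simps)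
  also have "\<dots> \<le> ?q ^ Suc d * ?q ^ Suc d"
    using card_vanishing_forms[OF assms(2)] by (intro mult_le_mono) auto
  also have "\<dots> = ?q ^ (2 * d + 1) * ?q" by (simp add: power_add[symmetric] mult_2)
  finally show ?thesis by simp
qed

section \<open>A solution of least degree and the pairs proportional to it\<close>

locale minimal_pair =
  fixes S :: "'a::{field,finite} proj_line set" and b :: "'a proj_line \<Rightarrow> 'a proj_line"
    and w :: "'a poly \<times> 'a poly" and \<mu> :: nat and P\<^sub>0 :: "'a proj_line"
  assumes w: "w \<in> match_pairs \<mu> S b" "w \<noteq> 0"
    and minimal: "\<And>m v. m < \<mu> \<Longrightarrow> v \<in> match_pairs m S b \<Longrightarrow> v = 0"
    and P\<^sub>0: "P\<^sub>0 \<notin> S"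
begin

definition multiples :: "nat \<Rightarrow> ('a poly \<times> 'a poly) set" where
  "multiples m = {v \<in> match_pairs m S b. det w v = 0}"

lemma finite_multiples [simp]: "finite (multiples m)"
  by (simp add: multiples_def)

text \<open>As \<open>P\<^sub>0\<close> lies outside \<open>S\<close>, its point form has no zero on
  \<open>S\<close> and can be cancelled without losing the conditions.\<close>

lemma zero_pair_divide:
  assumes "v \<in> match_pairs (Suc m) S b"
    "form_eval (Suc m) (fst v) P\<^sub>0 = 0" "form_eval (Suc m) (snd v) P\<^sub>0 = 0"
  obtains v' where "v' \<in> match_pairs m S b" "v = (point_form P\<^sub>0 * fst v', point_form P\<^sub>0 * snd v')"
proof -
  obtain F where F: "F \<in> forms m" "fst v = point_form P\<^sub>0 * F"
    using assms form_root_factor[of "fst v" m P\<^sub>0] by (auto simp: match_pairs_def)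
  obtain G where G: "G \<in> forms m" "snd v = point_form P\<^sub>0 * G"
    using assms form_root_factor[of "snd v" m P\<^sub>0] by (auto simp: match_pairs_def)
  have v: "v = (point_form P\<^sub>0 * F, point_form P\<^sub>0 * G)" using F G by (simp add: prod_eq_iff)
  have "(F, G) \<in> match_pairs m S b"
    using match_pairs_cancel[OF point_form_in_forms F(1) G(1), of P\<^sub>0 S b] assms(1) v P\<^sub>0
      form_eval_point_form[of P\<^sub>0] by auto
  then show ?thesis using that[of "(F, G)"] v by simp
qed

lemma zero_pair_degree_0:
  assumes "v \<in> match_pairs 0 S b" "form_eval 0 (fst v) P = 0" "form_eval 0 (snd v) P = 0"
  shows "v = 0"
  using assms form_of_degree_0_root by (auto simp: match_pairs_def prod_eq_iff)

text \<open>A common zero at \<open>P\<^sub>0\<close> could be divided out, giving a nonzero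
  solution of degree below \<open>\<mu>\<close>.\<close>

lemma w_nonzero_at: "form_eval \<mu> (fst w) P\<^sub>0 \<noteq> 0 \<or> form_eval \<mu> (snd w) P\<^sub>0 \<noteq> 0"
proof (rule ccontr)
  assume "\<not> ?thesis"
  then have z: "form_eval \<mu> (fst w) P\<^sub>0 = 0" "form_eval \<mu> (snd w) P\<^sub>0 = 0" by auto
  show False
  proof (cases \<mu>)
    case 0
    then show False using zero_pair_degree_0 w z by blast
  next
    case (Suc m)
    then obtain v' where v': "v' \<in> match_pairs m S b"
      "w = (point_form P\<^sub>0 * fst v', point_form P\<^sub>0 * snd v')"
      using zero_pair_divide[of w m] w z by auto
    then have "v' = 0" using minimal[of m v'] Suc by simp
    then show False using v' w(2) by (simp add: prod_eq_iff)
  qed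
qed

lemma w_forms: "fst w \<in> forms \<mu>" "snd w \<in> forms \<mu>"
  using w by (auto simp: match_pairs_def)

lemma form_eval_det:
  assumes "v \<in> match_pairs m S b"
  shows "form_eval (m + \<mu>) (det w v) P =
    form_eval m (fst v) P * form_eval \<mu> (snd w) P - form_eval m (snd v) P * form_eval \<mu> (fst w) P"
  using assms w_forms by (simp add: det_def form_eval_diff form_eval_mult match_pairs_def)

lemma multiples_diff: "u \<in> multiples m \<Longrightarrow> v \<in> multiples m \<Longrightarrow> u - v \<in> multiples m"
  by (auto simp: multiples_def match_pairs_diff det_def algebra_simps)

text \<open>The vanishing determinant puts the value of \<open>v\<close> at \<open>P\<^sub>0\<close>
  on the line spanned by the nonzero value of \<open>w\<close>, so one coordinate determines
  it.\<close>

lemma card_multiples_le: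
  assumes "finite K"
    and K: "\<And>v. v \<in> multiples m \<Longrightarrow> form_eval m (fst v) P\<^sub>0 = 0 \<Longrightarrow> form_eval m (snd v) P\<^sub>0 = 0 \<Longrightarrow> v \<in> K"
  shows "card (multiples m) \<le> CARD('a) * card K"
proof (rule card_le_kernel_times_range)
  \<comment> \<open>A coordinate in which \<open>w\<close> is nonzero at
    \<open>P\<^sub>0\<close>.\<close>
  let ?c = "\<lambda>v. if form_eval \<mu> (fst w) P\<^sub>0 \<noteq> 0 then form_eval m (fst v) P\<^sub>0 else form_eval m (snd v) P\<^sub>0"
  fix u v assume uv: "u \<in> multiples m" "v \<in> multiples m" "?c u = ?c v"
  define x where "x = u - v"
  have x: "x \<in> multiples m" using uv multiples_diff by (simp add: x_def)
  have c: "?c x = 0" using uv(3) by (simp add: x_def form_eval_diff split: if_splits)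
  have "form_eval m (fst x) P\<^sub>0 * form_eval \<mu> (snd w) P\<^sub>0 - form_eval m (snd x) P\<^sub>0 * form_eval \<mu> (fst w) P\<^sub>0 = 0"
    using form_eval_det[of x m P\<^sub>0] x by (simp add: multiples_def)
  then have "form_eval m (fst x) P\<^sub>0 = 0 \<and> form_eval m (snd x) P\<^sub>0 = 0"
    using c w_nonzero_at by (auto split: if_splits)
  then show "u - v \<in> K" using K[of x] x by (simp add: x_def)
qed (use assms in auto)

text \<open>Raising the degree by one costs at most a factor q, because the multiples vanishing at
  \<open>P\<^sub>0\<close> come from one degree lower. Below \<open>\<mu>\<close> only 0 remains,
  and truncated subtraction makes the exponent 0.\<close>

lemma card_multiples: "card (multiples m) \<le> CARD('a) ^ (Suc m - \<mu>)"
proof (induction m)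
  case 0
  show ?case
  proof (cases "\<mu> = 0")
    case True
    have "card (multiples 0) \<le> CARD('a) * card {0 :: 'a poly \<times> 'a poly}"
      using zero_pair_degree_0 by (intro card_multiples_le) (auto simp: multiples_def)
    then show ?thesis using True by simp
  next
    case False
    then have "multiples 0 \<subseteq> {0}" using minimal by (auto simp: multiples_def)
    then have "card (multiples 0) \<le> card {0 :: 'a poly \<times> 'a poly}" by (intro card_mono) auto
    then show ?thesis using False by simp
  qed
next
  case (Suc m)
  show ?case
  proof (cases "\<mu> \<le> Suc m")
    case True
    let ?L = "\<lambda>v. (point_form P\<^sub>0 * fst v, point_form P\<^sub>0 * snd v)"
    have "card (multiples (Suc m)) \<le> CARD('a) * card (?L ` multiples m)"
    proof (rule card_multiples_le)
      fix v assume v: "v \<in> multiples (Suc m)"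
        "form_eval (Suc m) (fst v) P\<^sub>0 = 0" "form_eval (Suc m) (snd v) P\<^sub>0 = 0"
      then obtain v' where v': "v' \<in> match_pairs m S b" "v = ?L v'"
        using zero_pair_divide[of v m] by (auto simp: multiples_def)
      have "det w v = point_form P\<^sub>0 * det w v'" using v' by (simp add: det_def algebra_simps)
      then have "det w v' = 0" using v by (simp add: multiples_def)
      then show "v \<in> ?L ` multiples m" using v' by (auto simp: multiples_def)
    qed simp
    also have "\<dots> \<le> CARD('a) * CARD('a) ^ (Suc m - \<mu>)"
      by (intro mult_le_mono2 le_trans[OF card_image_le Suc]) simp
    finally show ?thesis using True by (simp add: Suc_diff_le)
  next
    case False
    then have "multiples (Suc m) \<subseteq> {0}" using minimal[of "Suc m"] by (auto simp: multiples_def)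
    then have "card (multiples (Suc m)) \<le> card {0 :: 'a poly \<times> 'a poly}" by (intro card_mono) auto
    also have "\<dots> \<le> CARD('a) ^ (Suc (Suc m) - \<mu>)" by simp
    finally show ?thesis .
  qed
qed

text \<open>\<open>det w\<close> maps solutions to forms of degree \<open>m + \<mu>\<close>
  vanishing on \<open>S\<close>, with kernel \<open>multiples m\<close>. In the sum of the exponents
  \<open>m + \<mu> + 1 - card S\<close> and \<open>m + 1 - \<mu>\<close> the unknown
  \<open>\<mu>\<close> cancels.\<close>

lemma card_non_multiples:
  "card (match_pairs m S b - multiples m) * CARD('a) ^ card S \<le> CARD('a) ^ (2 * m + 2)"
proof (cases "match_pairs m S b - multiples m = {}")
  case True
  show ?thesis unfolding True by simp
next
  case False
  let ?q = "CARD('a)"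
  have det_vanishing: "det w v \<in> vanishing_forms (m + \<mu>) S" if v: "v \<in> match_pairs m S b" for v
  proof -
    have "det w v \<in> forms (m + \<mu>)"
      using v w_forms by (auto simp: det_def match_pairs_def intro: forms_diff forms_mult)
    moreover have "form_eval (m + \<mu>) (det w v) P = 0" if "P \<in> S" for P
      unfolding form_eval_det[OF v] using v w(1) that
      by (intro lin_cond_parallel[where B = "b P"]) (auto simp: match_pairs_def)
    ultimately show ?thesis by (simp add: vanishing_forms_def)
  qed
  \<comment> \<open>One solution outside \<open>multiples m\<close> yields both inequalities that
    the exponents need: its determinant is a nonzero form vanishing on \<open>S\<close>, and it is
    itself a nonzero solution.\<close>
  obtain v where v: "v \<in> match_pairs m S b" "det w v \<noteq> 0" using False by (auto simp: multiples_def)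
  then have k: "card S \<le> m + \<mu>" using form_many_roots det_vanishing by (meson not_le)
  have "v \<noteq> 0" using v by (auto simp: det_def)
  then have m: "\<mu> \<le> m" using minimal v by (meson not_le)
  have "card (match_pairs m S b - multiples m) \<le> card (match_pairs m S b)"
    by (intro card_mono) auto
  also have "\<dots> \<le> card (vanishing_forms (m + \<mu>) S) * card (multiples m)"
  proof (rule card_le_kernel_times_range)
    fix u v assume uv: "u \<in> match_pairs m S b" "v \<in> match_pairs m S b" "det w u = det w v"
    have "det w (u - v) = det w u - det w v" by (simp add: det_def algebra_simps)
    then show "u - v \<in> multiples m" using uv match_pairs_diff by (simp add: multiples_def)
  qed (use det_vanishing in auto)
  finally have "card (match_pairs m S b - multiples m) * ?q ^ card S
      \<le> (card (vanishing_forms (m + \<mu>) S) * card (multiples m)) * ?q ^ card S"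
    by (rule mult_le_mono1)
  also have "\<dots> = (card (vanishing_forms (m + \<mu>) S) * ?q ^ card S) * card (multiples m)"
    by simp
  also have "\<dots> \<le> ?q ^ Suc (m + \<mu>) * ?q ^ (Suc m - \<mu>)"
    using card_vanishing_forms[of S "m + \<mu>"] card_multiples[of m] k by (intro mult_le_mono) auto
  also have "\<dots> = ?q ^ (2 * m + 2)" using m by (simp add: power_add[symmetric] mult_2 del: power_Suc)
  finally show ?thesis .
qed

end

section \<open>Counting coprime pairs with prescribed values\<close>

text \<open>For the associated forms, coprimality excludes common zeros at finite points and the
  degree condition excludes one at infinity.\<close>

definition coprime_pairs :: "nat \<Rightarrow> ('a::field poly \<times> 'a poly) set" where
  "coprime_pairs d = {(f, g). coprime f g \<and> max (degree f) (degree g) = d}"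

definition pair_map :: "nat \<Rightarrow> 'a::field poly \<times> 'a poly \<Rightarrow> 'a proj_line \<Rightarrow> 'a proj_line" where
  "pair_map d v P = proj_quot (form_eval d (fst v) P) (form_eval d (snd v) P)"

lemma coprime_pairs_subset: "coprime_pairs d \<subseteq> forms d \<times> forms d"
  by (auto simp: coprime_pairs_def forms_def)

lemma finite_coprime_pairs [simp]: "finite (coprime_pairs d :: ('a::{field,finite} poly \<times> 'a poly) set)"
  by (rule finite_subset[OF coprime_pairs_subset]) simp

lemma common_form_factor:
  fixes v :: "'a::field poly \<times> 'a poly"
  assumes "fst v \<in> forms d" "snd v \<in> forms d" "v \<noteq> 0" "v \<notin> coprime_pairs d" "d > 0"
  obtains e H F G where "1 \<le> e" "e \<le> d" "H \<in> monic_forms e" "F \<in> forms (d - e)" "G \<in> forms (d - e)"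
    "v = (H * F, H * G)"
proof (cases "coprime (fst v) (snd v)")
  case True
  then have "max (degree (fst v)) (degree (snd v)) \<noteq> d"
    using assms(4) by (auto simp: coprime_pairs_def case_prod_beta)
  then have "degree (fst v) \<le> d - 1" "degree (snd v) \<le> d - 1"
    using assms(1,2) by (auto simp: forms_def max_def split: if_splits)
  \<comment> \<open>Both degrees drop, so the common factor is \<open>Y\<close>, of form degree 1
    and dehomogenized to 1.\<close>
  then show ?thesis
    using that[of 1 1 "fst v" "snd v"] assms(5) by (simp add: forms_def monic_forms_def)
next
  case False
  then obtain c where c: "c dvd fst v" "c dvd snd v" "\<not> is_unit c" unfolding coprime_def by blast
  have c0: "c \<noteq> 0" using c(1,2) assms(3) by (auto simp: prod_eq_iff)
  define H where "H = smult (inverse (lead_coeff c)) c"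
  have H: "H dvd fst v" "H dvd snd v" "lead_coeff H = 1" "degree H = degree c"
    using c c0 by (auto simp: H_def smult_dvd_iff)
  obtain F G where FG: "fst v = H * F" "snd v = H * G" using H(1,2) by (auto elim!: dvdE)
  have H0: "H \<noteq> 0" using H(3) by auto
  have e: "1 \<le> degree H" using H(4) c(3) c0 is_unit_iff_degree by fastforce
  have deg: "degree F \<le> d - degree H" if "H * F \<in> forms d" for F
    using that H0 by (cases "F = 0") (auto simp: forms_def degree_mult_eq)
  have "degree H \<le> d"
  proof -
    have "F \<noteq> 0 \<or> G \<noteq> 0" using assms(3) FG by (auto simp: prod_eq_iff)
    then show ?thesis
      using assms(1,2) FG H0 by (auto simp: forms_def degree_mult_eq)
  qed
  then show ?thesis
    using that[of "degree H" H F G] e H(3) FG deg[of F] deg[of G] assms(1,2)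
    by (simp add: forms_def monic_forms_def prod_eq_iff)
qed

lemma sum_decreasing_powers:
  fixes q :: nat
  assumes "1 \<le> q" "d \<le> n"
  shows "(q - 1) * (\<Sum>e=1..d. q ^ (n - e)) + q ^ (n - d) = q ^ n"
  using assms(2)
proof (induction d)
  case (Suc d)
  have "q ^ (n - d) = q * q ^ (n - Suc d)" using Suc.prems by (simp add: Suc_diff_Suc flip: power_Suc)
  also have "\<dots> = (q - 1) * q ^ (n - Suc d) + q ^ (n - Suc d)"
    using assms(1) by (simp add: algebra_simps)
  finally show ?case using Suc by (simp add: algebra_simps)
qed simp

text \<open>A union bound, with k = \<open>card S\<close>: common zeros on \<open>S\<close>,
  multiples of \<open>w\<close> and products \<open>H * v\<close> cost at most k, 1 and 3 times q^(2
  * d + 1 - k).\<close>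

lemma card_coprime_match:
  fixes S :: "'a::{field,finite} proj_line set"
  assumes "card S \<le> d" "card S \<le> CARD('a)" "0 < d" "3 \<le> CARD('a)"
  shows "real (CARD('a)) ^ (2 * d + 2) * (1 - (real (card S) + 4) / real CARD('a)) \<le>
    real (card {v \<in> coprime_pairs d. \<forall>P\<in>S. pair_map d v P = b P}) * real CARD('a) ^ card S"
proof -
  let ?q = "CARD('a)" and ?k = "card S"
  let ?V = "match_pairs d S b"
  have "S \<noteq> UNIV" using assms(2) by (auto simp: card_UNIV_option)
  then obtain P\<^sub>0 where P\<^sub>0: "P\<^sub>0 \<notin> S" by blast
  \<comment> \<open>There are fewer conditions than the dimension 2 * d + 2.\<close>
  have "\<exists>v \<in> ?V. v \<noteq> 0"
  proof (rule ccontr)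
    assume "\<not> ?thesis"
    then have "card ?V \<le> card {0 :: 'a poly \<times> 'a poly}" by (intro card_mono) auto
    then have "card ?V * ?q ^ ?k \<le> 1 * ?q ^ ?k" by (intro mult_le_mono1) simp
    from le_trans[OF card_match_pairs_ge this] have "?q ^ (2 * d + 2) \<le> ?q ^ ?k"
      by (simp only: mult_1)
    then show False using assms(1,4) by (simp add: power_le_imp_le_exp del: power_Suc)
  qed
  define \<mu> where "\<mu> = (LEAST m. \<exists>v \<in> match_pairs m S b. v \<noteq> 0)"
  have "\<exists>v \<in> match_pairs \<mu> S b. v \<noteq> 0"
    unfolding \<mu>_def by (rule LeastI[of _ d]) fact
  then obtain w where w: "w \<in> match_pairs \<mu> S b" "w \<noteq> 0" by blast
  have min: "v = 0" if "m < \<mu>" "v \<in> match_pairs m S b" for m v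
    using not_less_Least[of m "\<lambda>m. \<exists>v \<in> match_pairs m S b. v \<noteq> 0"] that unfolding \<mu>_def by blast
  interpret minimal_pair S b w \<mu> P\<^sub>0 by standard (use w min P\<^sub>0 in auto)
  let ?N = "{v \<in> coprime_pairs d. \<forall>P\<in>S. pair_map d v P = b P}"
  let ?W = "\<Union>P\<in>S. common_zero_pairs d S b P"
  let ?D = "\<lambda>e. (\<lambda>(H, v). (H * fst v, H * snd v)) `
              (monic_forms e \<times> (match_pairs (d - e) S b - multiples (d - e)))"
  let ?U = "\<Union>e\<in>{1..d}. ?D e"
  have fN: "finite ?N" by simp
  have fW: "finite ?W" by (auto simp: common_zero_pairs_def)
  \<comment> \<open>A solution without common zero on \<open>S\<close> matches \<open>b\<close>, so
    outside \<open>?N\<close> it is not coprime. Its common factor \<open>H\<close> has no zero on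
    \<open>S\<close>, so the cofactor is again a solution, and
    \<open>det w v = H * det w (F, G)\<close> keeps it out of the multiples.\<close>
  have "?V \<subseteq> ?N \<union> (?W \<union> (multiples d \<union> ?U))"
  proof
    fix v assume v: "v \<in> ?V"
    show "v \<in> ?N \<union> (?W \<union> (multiples d \<union> ?U))"
    proof (rule ccontr)
      assume n: "v \<notin> ?N \<union> (?W \<union> (multiples d \<union> ?U))"
      have nz: "form_eval d (fst v) P \<noteq> 0 \<or> form_eval d (snd v) P \<noteq> 0" if "P \<in> S" for P
        using n v that by (auto simp: common_zero_pairs_def)
      have "pair_map d v P = b P" if "P \<in> S" for P
        unfolding pair_map_def using v nz that by (intro proj_quot_eq) (auto simp: match_pairs_def)
      then have "v \<notin> coprime_pairs d" using n by auto
      moreover have "v \<noteq> 0" using n by (auto simp: multiples_def det_def)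
      moreover have "fst v \<in> forms d" "snd v \<in> forms d" using v by (auto simp: match_pairs_def)
      ultimately obtain e H F G where e: "1 \<le> e" "e \<le> d" and H: "H \<in> monic_forms e"
        and FG: "F \<in> forms (d - e)" "G \<in> forms (d - e)" and vH: "v = (H * F, H * G)"
        using assms(3) by - (rule common_form_factor)
      have He: "H \<in> forms e" using H by (simp add: monic_forms_def forms_def)
      have "form_eval e H P \<noteq> 0" if "P \<in> S" for P
      proof
        assume "form_eval e H P = 0"
        then have "form_eval (e + (d - e)) (H * F) P = 0" "form_eval (e + (d - e)) (H * G) P = 0"
          using form_eval_mult[OF He FG(1)] form_eval_mult[OF He FG(2)] by auto
        then show False using nz[OF that] vH e by simp
      qed
      then have "(F, G) \<in> match_pairs (d - e) S b"
        using match_pairs_cancel[OF He FG, of S b] v vH e by simp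
      moreover have "det w v = H * det w (F, G)" by (simp add: vH det_def algebra_simps)
      then have "(F, G) \<notin> multiples (d - e)" using n v by (auto simp: multiples_def)
      ultimately have "v \<in> ?D e" using H vH by (intro image_eqI[of _ _ "(H, (F, G))"]) auto
      then show False using n e by auto
    qed
  qed
  then have "card ?V \<le> card (?N \<union> (?W \<union> (multiples d \<union> ?U)))"
    using fN fW by (intro card_mono) auto
  also have "\<dots> \<le> card ?N + (card ?W + (card (multiples d) + card ?U))"
    by (meson card_Un_le le_trans add_le_mono le_refl)
  also have "card ?W \<le> (\<Sum>P\<in>S. card (common_zero_pairs d S b P))" by (rule card_UN_le) simp
  also have "card ?U \<le> (\<Sum>e=1..d. card (?D e))" by (rule card_UN_le) simp
  finally have "card ?V * ?q ^ ?k \<le> (card ?N + ((\<Sum>P\<in>S. card (common_zero_pairs d S b P))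
      + (card (multiples d) + (\<Sum>e=1..d. card (?D e))))) * ?q ^ ?k"
    by (intro mult_le_mono1) simp
  then have "?q ^ (2 * d + 2) \<le> card ?N * ?q ^ ?k + ((\<Sum>P\<in>S. card (common_zero_pairs d S b P) * ?q ^ ?k)
      + (card (multiples d) * ?q ^ ?k + (\<Sum>e=1..d. card (?D e) * ?q ^ ?k)))"
    using card_match_pairs_ge[of d S b] by (simp add: algebra_simps sum_distrib_left)
  also have "(\<Sum>P\<in>S. card (common_zero_pairs d S b P) * ?q ^ ?k) \<le> (\<Sum>P\<in>S. ?q ^ (2 * d + 1))"
    using assms(1) by (intro sum_mono card_common_zero_pairs) auto
  also have "card (multiples d) * ?q ^ ?k \<le> ?q ^ (Suc d - \<mu>) * ?q ^ ?k"
    by (intro mult_le_mono1 card_multiples)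
  \<comment> \<open>Since \<open>card S \<le> d\<close>, the combined exponent is at most
    \<open>Suc d + d\<close>.\<close>
  also have "\<dots> \<le> ?q ^ (2 * d + 1)"
    unfolding power_add[symmetric] using assms(1,4) by (intro power_increasing) auto
  \<comment> \<open>There are fewer than 2 * q^e choices of \<open>H\<close>, while lowering the
    degree of the cofactor by \<open>e\<close> saves q^(2 * e).\<close>
  also have "(\<Sum>e=1..d. card (?D e) * ?q ^ ?k) \<le> (\<Sum>e=1..d. 2 * ?q ^ (2 * d + 2 - e))"
  proof (rule sum_mono)
    fix e assume e: "e \<in> {1..d}"
    have "card (?D e) \<le> card ((monic_forms e :: 'a poly set) \<times> (match_pairs (d - e) S b - multiples (d - e)))"
      by (rule card_image_le) auto
    then have "card (?D e) * ?q ^ ?k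
        \<le> card (monic_forms e :: 'a poly set) * (card (match_pairs (d - e) S b - multiples (d - e)) * ?q ^ ?k)"
      by (simp add: card_cartesian_product mult.assoc[symmetric])
    also have "\<dots> \<le> (2 * ?q ^ e) * ?q ^ (2 * (d - e) + 2)"
      using card_monic_forms[of e, where 'a='a] by (intro mult_le_mono card_non_multiples) simp
    also have "\<dots> = 2 * ?q ^ (e + (2 * (d - e) + 2))" by (simp only: mult.assoc power_add)
    also have "e + (2 * (d - e) + 2) = 2 * d + 2 - e" using e by auto
    finally show "card (?D e) * ?q ^ ?k \<le> 2 * ?q ^ (2 * d + 2 - e)" .
  qed
  also have "(\<Sum>e=1..d. 2 * ?q ^ (2 * d + 2 - e)) \<le> 3 * ?q ^ (2 * d + 1)"
  proof -
    have "(?q - 1) * (\<Sum>e=1..d. ?q ^ (2 * d + 2 - e)) \<le> ?q ^ (2 * d + 2)"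
      using sum_decreasing_powers[of ?q d "2 * d + 2"] assms(4) by linarith
    then have "(?q - 1) * (\<Sum>e=1..d. 2 * ?q ^ (2 * d + 2 - e)) \<le> (2 * ?q) * ?q ^ (2 * d + 1)"
      by (simp flip: sum_distrib_left add: mult.left_commute)
    \<comment> \<open>This is 2 * q \<le> 3 * (q - 1), that is, q \<ge> 3.\<close>
    also have "\<dots> \<le> ((?q - 1) * 3) * ?q ^ (2 * d + 1)"
      using assms(4) by (intro mult_le_mono1) simp
    finally show ?thesis using assms(4) by (simp add: mult.assoc)
  qed
  finally have main: "?q ^ (2 * d + 2) \<le> card ?N * ?q ^ ?k + (?k + 4) * ?q ^ (2 * d + 1)"
    by (simp add: algebra_simps)
  have "real ?q ^ (2 * d + 2) \<le> real (card ?N) * real ?q ^ ?k + (real ?k + 4) * real ?q ^ (2 * d + 1)"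
    using of_nat_mono[OF main, where 'a=real] by simp
  moreover have "real ?q ^ (2 * d + 2) * (1 - (real ?k + 4) / real ?q)
      = real ?q ^ (2 * d + 2) - (real ?k + 4) * real ?q ^ (2 * d + 1)"
    using assms(4) by (simp add: field_simps)
  ultimately show ?thesis by simp
qed

section \<open>Periodic points and cycles\<close>

definition injective_words :: "nat \<Rightarrow> 'b list set" where
  "injective_words k = {xs. length xs = k \<and> distinct xs}"

definition is_cycle :: "('b \<Rightarrow> 'b) \<Rightarrow> 'b list \<Rightarrow> bool" where
  "is_cycle h xs \<longleftrightarrow> (\<forall>i<length xs. h (xs ! i) = xs ! (Suc i mod length xs))"

lemma finite_injective_words [simp]: "finite (injective_words k :: 'b::finite list set)"
  by (rule finite_subset[OF _ finite_lists_length_eq[of UNIV k]]) (auto simp: injective_words_def)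

lemma card_injective_words:
  assumes "k \<le> CARD('b::finite)"
  shows "real (card (injective_words k :: 'b list set)) = (\<Prod>j<k. real CARD('b) - real j)"
proof -
  have "card (injective_words k :: 'b list set) = \<Prod>{CARD('b) - k + 1..CARD('b)}"
    using card_lists_distinct_length_eq[of "UNIV :: 'b set" k] assms by (simp add: injective_words_def)
  also have "\<dots> = (\<Prod>j<k. CARD('b) - j)"
    using assms by (intro prod.reindex_bij_witness[of _ "\<lambda>j. CARD('b) - j" "\<lambda>i. CARD('b) - i"]) auto
  also have "real \<dots> = (\<Prod>j<k. real CARD('b) - real j)"
    using assms by (simp add: of_nat_diff)
  finally show ?thesis .
qed

lemma cycle_iterate:
  assumes "is_cycle h xs" "xs \<noteq> []"
  shows "(h ^^ n) (hd xs) = xs ! (n mod length xs)"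
proof (induction n)
  case 0
  then show ?case using assms(2) by (simp add: hd_conv_nth)
next
  case (Suc n)
  have "n mod length xs < length xs" using assms(2) by simp
  then show ?case using Suc assms(1) by (simp add: is_cycle_def mod_Suc_eq)
qed

text \<open>If one cycle were shorter, the orbit of the head would return too early for the entries
  of the longer one to be distinct. With equal lengths both list the same iterates of the
  head.\<close>

lemma cycles_with_same_head:
  assumes "is_cycle h xs" "is_cycle h ys" "distinct xs" "distinct ys" "xs \<noteq> []" "ys \<noteq> []"
    and "hd xs = hd ys"
  shows "xs = ys"
proof -
  have le: "length us \<le> length vs"
    if "is_cycle h us" "is_cycle h vs" "distinct us" "us \<noteq> []" "vs \<noteq> []" "hd us = hd vs" for us vs
  proof (rule ccontr)
    assume "\<not> ?thesis"
    then have l: "length vs < length us" by simp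
    have "us ! length vs = (h ^^ length vs) (hd vs)"
      using cycle_iterate[of h us "length vs"] that l by simp
    also have "\<dots> = us ! 0" using cycle_iterate[of h vs "length vs"] that by (simp add: hd_conv_nth)
    finally show False using l that by (simp add: nth_eq_iff_index_eq)
  qed
  have "length xs = length ys" using le[of xs ys] le[of ys xs] assms by simp
  moreover have "xs ! i = ys ! i" if "i < length xs" for i
    using cycle_iterate[of h xs i] cycle_iterate[of h ys i] assms that calculation by simp
  ultimately show ?thesis by (rule nth_equalityI)
qed

text \<open>Different words have different heads, and a cycle of length k read from each of its k
  entries accounts for k periodic points. Periods above \<open>n\<close> are ignored.\<close>

lemma card_periodic_points_ge:
  fixes h :: "'b::finite \<Rightarrow> 'b"
  shows "(\<Sum>k=1..n. card {xs \<in> injective_words k. is_cycle h xs}) \<le> card (periodic_points h)"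
proof -
  let ?A = "\<lambda>k. {xs \<in> injective_words k. is_cycle h xs}"
  have "(\<Sum>k=1..n. card (?A k)) = card (\<Union>k\<in>{1..n}. ?A k)"
    by (rule card_UN_disjoint[symmetric]) (simp_all, auto simp: injective_words_def)
  also have "\<dots> \<le> card (periodic_points h)"
  proof (rule card_inj_on_le)
    show "inj_on hd (\<Union>k\<in>{1..n}. ?A k)"
      by (rule inj_onI) (auto simp: injective_words_def intro!: cycles_with_same_head[of h])
    show "hd ` (\<Union>k\<in>{1..n}. ?A k) \<subseteq> periodic_points h"
    proof (intro image_subsetI)
      fix xs assume "xs \<in> (\<Union>k\<in>{1..n}. ?A k)"
      then have xs: "1 \<le> length xs" "is_cycle h xs" by (auto simp: injective_words_def)
      then have "(h ^^ length xs) (hd xs) = hd xs"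
        using cycle_iterate[of h xs "length xs"] by (cases xs) auto
      then show "hd xs \<in> periodic_points h" using xs(1) by (auto simp: periodic_points_def)
    qed
  qed simp
  finally show ?thesis .
qed

text \<open>Distinctness makes the successor of an entry well defined. As \<open>b\<close> does not
  depend on \<open>h\<close>, the same prescribed values serve all rational functions.\<close>

lemma is_cycle_as_prescribed_values:
  assumes "distinct xs"
  shows "\<exists>b. \<forall>h. is_cycle h xs \<longleftrightarrow> (\<forall>P\<in>set xs. h P = b P)"
proof -
  define b where "b = (\<lambda>P. xs ! (Suc (inv_into {..<length xs} ((!) xs) P) mod length xs))"
  have "inj_on ((!) xs) {..<length xs}" using assms by (simp add: inj_on_nth)
  then have "b (xs ! i) = xs ! (Suc i mod length xs)" if "i < length xs" for i
    unfolding b_def using that by (simp add: inv_into_f_f)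
  then have "is_cycle h xs \<longleftrightarrow> (\<forall>P\<in>set xs. h P = b P)" for h
    unfolding is_cycle_def by (metis in_set_conv_nth)
  then show ?thesis by blast
qed

section \<open>Rational functions\<close>

lemma lowest_terms_Fract:
  "coprime f g \<Longrightarrow> lead_coeff g = 1 \<Longrightarrow> lowest_terms (Fraction_Field.Fract f g) = (f, g)"
  unfolding lowest_terms_def by (rule the1_equality[OF lowest_terms_ex1]) simp

lemma lowest_terms_cases:
  obtains f g where "lowest_terms s = (f, g)" "s = Fraction_Field.Fract f g" "coprime f g" "lead_coeff g = 1"
  using theI'[OF lowest_terms_ex1[of s]] that unfolding lowest_terms_def[symmetric]
  by (cases "lowest_terms s") auto

lemma rat_map_eq_pair_map:
  assumes "lowest_terms s = (f, g)" "max (degree f) (degree g) = d"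
  shows "rat_map (Some s) P = pair_map d (f, g) P"
  using assms by (auto simp: rat_map_def pair_map_def form_eval_def Let_def split: option.splits)

lemma pair_map_smult:
  "c \<noteq> 0 \<Longrightarrow> pair_map d (smult c f, smult c g) P = pair_map d (f, g) P"
  by (simp add: pair_map_def form_eval_smult proj_quot_def)

lemma coprime_smult_smult:
  fixes f g :: "'a::field poly"
  shows "c \<noteq> 0 \<Longrightarrow> coprime (smult c f) (smult c g) \<longleftrightarrow> coprime f g"
  unfolding coprime_def by (simp add: dvd_smult_iff)

lemma rat_funs_of_degree_cases:
  assumes "r \<in> rat_funs_of_degree d" "0 < d"
  obtains f g where "r = Some (Fraction_Field.Fract f g)" "lowest_terms (Fraction_Field.Fract f g) = (f, g)"
    "coprime f g" "lead_coeff g = 1" "max (degree f) (degree g) = d"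
proof -
  obtain s where s: "r = Some s" using assms by (cases r) (auto simp: rat_funs_of_degree_def rat_degree_def)
  obtain f g where "lowest_terms s = (f, g)" "s = Fraction_Field.Fract f g" "coprime f g" "lead_coeff g = 1"
    by (rule lowest_terms_cases)
  then show ?thesis using that[of f g] s assms by (simp add: rat_funs_of_degree_def rat_degree_def)
qed

text \<open>Coprime representations of one function differ by a nonzero scalar; as
  \<open>lowest_terms\<close> has a monic denominator, the scalar is the leading coefficient of the
  given denominator. Empty \<open>S\<close> gives the count of all functions of degree
  \<open>d\<close>.\<close>

lemma bij_betw_coprime_pairs:
  fixes S :: "'a::{field,finite} proj_line set"
  assumes "0 < d"
  shows "bij_betw (\<lambda>(c, r). case lowest_terms (the r) of (f, g) \<Rightarrow> (smult c f, smult c g))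
    ((UNIV - {0}) \<times> {r \<in> rat_funs_of_degree d. \<forall>P\<in>S. rat_map r P = b P})
    {v \<in> coprime_pairs d. \<forall>P\<in>S. pair_map d v P = b P}"
    (is "bij_betw ?\<phi> (?C \<times> ?R) ?V")
proof (rule bij_betwI[where g = "\<lambda>v. (lead_coeff (snd v), Some (Fraction_Field.Fract (fst v) (snd v)))"])
  show "?\<phi> \<in> ?C \<times> ?R \<rightarrow> ?V"
  proof (rule Pi_I)
    fix x assume "x \<in> ?C \<times> ?R"
    then obtain c r where x: "x = (c, r)" "c \<noteq> 0" "r \<in> ?R" by auto
    then have "r \<in> rat_funs_of_degree d" by simp
    then obtain f g where r: "r = Some (Fraction_Field.Fract f g)"
      "lowest_terms (Fraction_Field.Fract f g) = (f, g)"
      "coprime f g" "max (degree f) (degree g) = d" using assms by (rule rat_funs_of_degree_cases)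
    then show "?\<phi> x \<in> ?V" using x rat_map_eq_pair_map[OF r(2,4)]
      by (auto simp: coprime_pairs_def coprime_smult_smult pair_map_smult)
  qed
  have V: "lead_coeff G \<noteq> 0 \<and> lowest_terms (Fraction_Field.Fract F G) =
      (smult (inverse (lead_coeff G)) F, smult (inverse (lead_coeff G)) G)" if "(F, G) \<in> coprime_pairs d" for F G :: "'a poly"
  proof -
    \<comment> \<open>With \<open>G = 0\<close>, coprimality would make \<open>F\<close> a nonzero
      constant, contrary to \<open>0 < d\<close>.\<close>
    have "G \<noteq> 0" using that assms by (auto simp: coprime_pairs_def elim!: is_unit_polyE)
    moreover from this have "Fraction_Field.Fract F G = Fraction_Field.Fract (smult (inverse (lead_coeff G)) F)
      (smult (inverse (lead_coeff G)) G)" by (simp add: eq_fract)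
    ultimately show ?thesis using that
      by (simp add: coprime_pairs_def coprime_smult_smult lowest_terms_Fract)
  qed
  show "(\<lambda>v. (lead_coeff (snd v), Some (Fraction_Field.Fract (fst v) (snd v)))) \<in> ?V \<rightarrow> ?C \<times> ?R"
  proof (rule Pi_I)
    fix v assume v: "v \<in> ?V"
    obtain F G where FG: "v = (F, G)" by (cases v)
    define c where "c = inverse (lead_coeff G)"
    have c: "c \<noteq> 0" "lowest_terms (Fraction_Field.Fract F G) = (smult c F, smult c G)"
      "lead_coeff G \<noteq> 0" "max (degree F) (degree G) = d"
      using V[of F G] v FG by (auto simp: c_def coprime_pairs_def)
    then have "rat_map (Some (Fraction_Field.Fract F G)) P = pair_map d v P" for P
      using rat_map_eq_pair_map[OF c(2), of d P] pair_map_smult[OF c(1), of d F G P] FG by simp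
    then show "(lead_coeff (snd v), Some (Fraction_Field.Fract (fst v) (snd v))) \<in> ?C \<times> ?R"
      using v c FG by (simp add: rat_funs_of_degree_def rat_degree_def)
  qed
  show "(lead_coeff (snd (?\<phi> x)), Some (Fraction_Field.Fract (fst (?\<phi> x)) (snd (?\<phi> x)))) = x"
    if xCR: "x \<in> ?C \<times> ?R" for x
  proof -
    obtain c r where x: "x = (c, r)" "c \<noteq> 0" "r \<in> ?R" using xCR by auto
    then have "r \<in> rat_funs_of_degree d" by simp
    then obtain f g where r: "r = Some (Fraction_Field.Fract f g)"
      "lowest_terms (Fraction_Field.Fract f g) = (f, g)" "lead_coeff g = 1"
      using assms by (rule rat_funs_of_degree_cases)
    moreover have "g \<noteq> 0" using r(3) by auto
    then have "Fraction_Field.Fract (smult c f) (smult c g) = Fraction_Field.Fract f g"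
      using x(2) by (simp add: eq_fract)
    ultimately show ?thesis using x by (simp add: lead_coeff_smult del: lead_coeff_smult)
  qed
  show "?\<phi> (lead_coeff (snd v), Some (Fraction_Field.Fract (fst v) (snd v))) = v" if "v \<in> ?V" for v
    using that V[of "fst v" "snd v"] by (auto simp: case_prod_beta prod_eq_iff)
qed

lemma card_matching_rat_funs:
  fixes S :: "'a::{field,finite} proj_line set"
  assumes "0 < d"
  shows "(CARD('a) - 1) * card {r \<in> rat_funs_of_degree d. \<forall>P\<in>S. rat_map r P = b P} =
    card {v \<in> coprime_pairs d. \<forall>P\<in>S. pair_map d v P = b P}"
  using bij_betw_same_card[OF bij_betw_coprime_pairs[OF assms, of S b]]
  by (simp add: card_cartesian_product card_Diff_subset)

lemma rat_funs_of_degree_finite_nonempty: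
  assumes "0 < d"
  shows "finite (rat_funs_of_degree d :: 'a::{field,finite} rat_fun set)"
    and "rat_funs_of_degree d \<noteq> ({} :: 'a rat_fun set)"
    and "(CARD('a) - 1) * card (rat_funs_of_degree d :: 'a rat_fun set) \<le> CARD('a) ^ (2 * d + 2)"
proof -
  let ?R = "rat_funs_of_degree d :: 'a rat_fun set" and ?C = "coprime_pairs d :: ('a poly \<times> 'a poly) set"
  have "(CARD('a) - 1) * card ?R = card ?C" using card_matching_rat_funs[OF assms, of "{}"] by simp
  have "finite ((UNIV - {0 :: 'a}) \<times> ?R)"
    using bij_betw_finite[OF bij_betw_coprime_pairs[OF assms, of "{}"]] by simp
  then show "finite ?R" by (rule finite_cartesian_productD2) (use one_neq_zero in blast)
  have "(monom 1 d, 1) \<in> ?C" by (simp add: coprime_pairs_def degree_monom_eq)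
  then have "card ?C \<noteq> 0" by auto
  then show "?R \<noteq> {}" using \<open>_ = card ?C\<close> by auto
  have "card ?C \<le> card (forms d \<times> forms d :: ('a poly \<times> 'a poly) set)"
    by (rule card_mono[OF _ coprime_pairs_subset]) simp
  also have "\<dots> = CARD('a) ^ Suc d * CARD('a) ^ Suc d"
    using card_forms[where 'a='a and m=d] by (simp add: card_cartesian_product)
  also have "\<dots> = CARD('a) ^ (2 * d + 2)" by (simp flip: power_add add: mult_2 del: power_Suc)
  finally show "(CARD('a) - 1) * card ?R \<le> CARD('a) ^ (2 * d + 2)" using \<open>_ = card ?C\<close> by simp
qed

lemma card_matching_rat_funs_ge:
  fixes S :: "'a::{field,finite} proj_line set"
  assumes "0 < d" "card S \<le> d" "card S \<le> CARD('a)"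
  shows "real (card (rat_funs_of_degree d :: 'a rat_fun set)) * (1 - (real (card S) + 4) / real CARD('a))
    \<le> real (card {r \<in> rat_funs_of_degree d. \<forall>P\<in>S. rat_map r P = b P}) * real CARD('a) ^ card S"
    (is "real ?R * ?p \<le> real ?M * _")
\<comment> \<open>Only a positive factor needs an argument, and it forces q >
  \<open>card S + 4\<close>, hence q \<ge> 3 as required by
  \<open>card_coprime_match\<close>.\<close>
proof (cases "?p \<le> 0")
  case True
  then have "real ?R * ?p \<le> 0" by (simp add: mult_nonneg_nonpos)
  also have "0 \<le> real ?M * real CARD('a) ^ card S" by simp
  finally show ?thesis .
next
  case False
  let ?q = "CARD('a)"
  have "real (card S) + 4 < real ?q"
    using False CARD_field_ge_2[where 'a='a] by (simp add: field_simps)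
  then have q: "3 \<le> ?q" by linarith
  have "real (?q - 1) * (real ?R * ?p) = real ((?q - 1) * ?R) * ?p" by simp
  also have "\<dots> \<le> real (?q ^ (2 * d + 2)) * ?p"
    using rat_funs_of_degree_finite_nonempty(3)[OF assms(1), where 'a='a] False
    by (intro mult_right_mono) (simp_all only: of_nat_le_iff)
  also have "\<dots> \<le> real (card {v \<in> coprime_pairs d. \<forall>P\<in>S. pair_map d v P = b P}) * real ?q ^ card S"
    using card_coprime_match[OF assms(2,3,1) q] by simp
  also have "\<dots> = real (?q - 1) * (real ?M * real ?q ^ card S)"
    by (simp flip: card_matching_rat_funs[OF assms(1)])
  finally show ?thesis using q by simp
qed

section \<open>The average number of periodic points\<close>

text \<open>Pairs of a function and a word that is one of its cycles are counted in both orders. The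
  upper limit \<open>n\<close> is free because terms with k + 4 > q are negative, and the second
  bound stops the sum earlier.\<close>

lemma average_periodic_points_ge:
  assumes "q = CARD('a::{field,finite})" "0 < d" "n \<le> min d q"
  shows "(\<Sum>k=1..n. ((\<Prod>j<k. (real q + 1 - real j)) / real q ^ k) * (1 - (real k + 4) / real q))
    \<le> average (\<lambda>r. real (card (periodic_points (rat_map r)))) (rat_funs_of_degree d :: 'a rat_fun set)"
    (is "(\<Sum>k=1..n. ?t k) \<le> _")
proof -
  let ?R = "rat_funs_of_degree d :: 'a rat_fun set"
  note R = rat_funs_of_degree_finite_nonempty[OF assms(2), where 'a='a]
  have q: "0 < q" using CARD_field_ge_2[where 'a='a] assms(1) by simp
  have words: "real (card ?R) * ?t k
      \<le> (\<Sum>xs\<in>injective_words k. real (card {r \<in> ?R. is_cycle (rat_map r) xs}))" if k: "k \<in> {1..n}" for k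
  proof -
    have "real (card ?R) * (1 - (real k + 4) / real q) / real q ^ k
        \<le> real (card {r \<in> ?R. is_cycle (rat_map r) xs})" if "xs \<in> injective_words k" for xs
    proof -
      have "distinct xs" using that by (simp add: injective_words_def)
      then obtain b :: "'a proj_line \<Rightarrow> 'a proj_line"
        where b: "\<And>h. is_cycle h xs \<longleftrightarrow> (\<forall>P\<in>set xs. h P = b P)"
        using is_cycle_as_prescribed_values by blast
      have "card (set xs) = k" using that by (simp add: injective_words_def distinct_card)
      then show ?thesis
        using card_matching_rat_funs_ge[OF assms(2), of "set xs" b] k assms(1,3) q
        by (simp add: b pos_divide_le_eq)
    qed
    then have "(\<Sum>xs\<in>(injective_words k :: 'a proj_line list set).
          real (card ?R) * (1 - (real k + 4) / real q) / real q ^ k)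
        \<le> (\<Sum>xs\<in>injective_words k. real (card {r \<in> ?R. is_cycle (rat_map r) xs}))"
      by (rule sum_mono)
    moreover have "real (card (injective_words k :: 'a proj_line list set)) = (\<Prod>j<k. real q + 1 - real j)"
      using card_injective_words[where 'b = "'a proj_line", of k] k assms(1,3)
      by (simp add: card_UNIV_option add.commute)
    ultimately show ?thesis by (simp add: ac_simps)
  qed
  \<comment> \<open>Cardinalities become sums of indicators, so that the sums over words and over
    functions can be exchanged.\<close>
  have filter: "real (card {x \<in> A. Q x}) = (\<Sum>x\<in>A. if Q x then 1 else 0)" if "finite A"
    for A :: "'x set" and Q
    using that by (simp flip: sum.inter_filter)
  have "real (card ?R) * (\<Sum>k=1..n. ?t k)
      \<le> (\<Sum>k=1..n. \<Sum>xs\<in>injective_words k. real (card {r \<in> ?R. is_cycle (rat_map r) xs}))"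
    unfolding sum_distrib_left by (rule sum_mono) (rule words)
  also have "\<dots> = (\<Sum>k=1..n. \<Sum>r\<in>?R. real (card {xs \<in> injective_words k. is_cycle (rat_map r) xs}))"
    by (rule sum.cong[OF refl], simp only: filter[OF R(1)] filter[OF finite_injective_words], rule sum.swap)
  also have "\<dots> = (\<Sum>r\<in>?R. real (\<Sum>k=1..n. card {xs \<in> injective_words k. is_cycle (rat_map r) xs}))"
    by (subst sum.swap) simp
  also have "\<dots> \<le> (\<Sum>r\<in>?R. real (card (periodic_points (rat_map r))))"
    by (intro sum_mono of_nat_mono card_periodic_points_ge)
  finally have "real (card ?R) * (\<Sum>k=1..n. ?t k) \<le> (\<Sum>r\<in>?R. real (card (periodic_points (rat_map r))))" .
  moreover have "0 < real (card ?R)" using R by (simp add: card_gt_0_iff)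
  ultimately show ?thesis unfolding average_def by (simp add: pos_le_divide_eq mult.commute)
qed

section \<open>Estimating the sum from below\<close>

lemma one_minus_sum_le_mult:
  fixes x y z :: real
  assumes "1 - x \<le> z" "0 \<le> x" "0 \<le> y" "y \<le> 1"
  shows "1 - (x + y) \<le> z * (1 - y)"
proof -
  have "1 - (x + y) \<le> (1 - x) * (1 - y)" using assms by (simp add: algebra_simps)
  also have "\<dots> \<le> z * (1 - y)" using assms by (intro mult_right_mono) auto
  finally show ?thesis .
qed

text \<open>The factors are 1 - (j - 1) / q, and a product of such factors is at least 1 minus the
  sum of the defects. For 1 \<le> j < k the j - 1 sum to (k - 1) * (k - 2) / 2; the factor 1 + 1 / q
  for j = 0 exceeds 1 and is dropped.\<close>

lemma falling_product_ge:
  assumes "0 < q" "k \<le> q"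
  shows "1 - (real k - 1) * (real k - 2) / (2 * real q) \<le> (\<Prod>j<k. real q + 1 - real j) / real q ^ k"
  using assms(2)
proof (induction k)
  case 0
  then show ?case using assms(1) by simp
next
  case (Suc k)
  let ?P = "(\<Prod>j<k. real q + 1 - real j) / real q ^ k"
  have step: "(\<Prod>j<Suc k. real q + 1 - real j) / real q ^ Suc k = ?P * (1 - (real k - 1) / real q)"
    using assms(1) by (simp add: field_simps)
  show ?case
  proof (cases "k = 0")
    case True
    then show ?thesis using assms(1) by (simp add: field_simps)
  next
    case False
    have "0 \<le> (real k - 1) * (real k - 2)"
      using False by (cases "k = 1") auto
    then have "1 - ((real k - 1) * (real k - 2) / (2 * real q) + (real k - 1) / real q)
        \<le> ?P * (1 - (real k - 1) / real q)"
      using False Suc assms(1) by (intro one_minus_sum_le_mult) (auto simp: divide_le_eq)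
    also have "(real k - 1) * (real k - 2) / (2 * real q) + (real k - 1) / real q
        = (real (Suc k) - 1) * (real (Suc k) - 2) / (2 * real q)"
      using assms(1) by (simp add: field_simps)
    finally show ?thesis unfolding step .
  qed
qed

text \<open>The k-th term loses at most (k^2 - k + 10) / (2 * q). The cubic part of the total loss,
  n^3 / (6 * q), is at most n / 6 since n^2 \<le> q; this is the source of 5 / 6.\<close>

lemma lower_bound_5_6:
  assumes "4 \<le> n" "n ^ 2 \<le> q"
  shows "5 / 6 * real n - 3
    \<le> (\<Sum>k=1..n. ((\<Prod>j<k. (real q + 1 - real j)) / real q ^ k) * (1 - (real k + 4) / real q))"
proof -
  have "4 * n \<le> n ^ 2" using assms(1) by (simp add: power2_eq_square)
  then have nq: "4 * n \<le> q" using assms(2) by linarith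
  then have q: "0 < q" using assms(1) by linarith
  have term_ge: "1 - (real k ^ 2 - real k + 10) / (2 * real q)
    \<le> ((\<Prod>j<k. (real q + 1 - real j)) / real q ^ k) * (1 - (real k + 4) / real q)" if k: "k \<in> {1..n}" for k
  proof -
    have "0 \<le> (real k - 1) * (real k - 2)" using k by (cases "k = 1") auto
    moreover have "k + 4 \<le> q" "k \<le> q" using k nq assms(1) by auto
    ultimately have "1 - ((real k - 1) * (real k - 2) / (2 * real q) + (real k + 4) / real q)
        \<le> ((\<Prod>j<k. (real q + 1 - real j)) / real q ^ k) * (1 - (real k + 4) / real q)"
      using q by (intro one_minus_sum_le_mult falling_product_ge) (auto simp: divide_le_eq)
    also have "(real k - 1) * (real k - 2) / (2 * real q) + (real k + 4) / real q
        = (real k ^ 2 - real k + 10) / (2 * real q)"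
      using q by (simp add: field_simps power2_eq_square)
    finally show ?thesis .
  qed
  have sum: "(\<Sum>k=1..m. 1 - (real k ^ 2 - real k + 10) / (2 * real q))
      = real m - ((real m ^ 3 - real m) / 3 + 10 * real m) / (2 * real q)" for m
  proof (induction m)
    case (Suc m)
    have "(\<Sum>k=1..Suc m. 1 - (real k ^ 2 - real k + 10) / (2 * real q))
        = real m - ((real m ^ 3 - real m) / 3 + 10 * real m) / (2 * real q)
          + (1 - (real (Suc m) ^ 2 - real (Suc m) + 10) / (2 * real q))"
      by (simp only: Suc.IH[symmetric]) simp
    also have "\<dots> = real (Suc m) - ((real (Suc m) ^ 3 - real (Suc m)) / 3 + 10 * real (Suc m)) / (2 * real q)"
      using q by (simp add: field_simps power2_eq_square power3_eq_cube)
    finally show ?case .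
  qed simp
  \<comment> \<open>Together with n^2 \<le> q this bounds the linear part 5 * n / q of the loss by
    3.\<close>
  have n: "10 * real n \<le> 6 * real n ^ 2" using assms(1) by (simp add: power2_eq_square)
  have "real n ^ 2 \<le> real q" using assms(2) by (simp flip: of_nat_power)
  then have "2 * real n ^ 2 * (real n / 6 + 3) \<le> 2 * real q * (real n / 6 + 3)"
    by (intro mult_right_mono) auto
  then have "(real n ^ 3 - real n) / 3 + 10 * real n \<le> 2 * real q * (real n / 6 + 3)"
    using n by (simp add: field_simps power2_eq_square power3_eq_cube)
  then have "((real n ^ 3 - real n) / 3 + 10 * real n) / (2 * real q) \<le> real n / 6 + 3"
    using q by (simp add: divide_le_eq mult.commute)
  then have "5 / 6 * real n - 3 \<le> (\<Sum>k=1..n. 1 - (real k ^ 2 - real k + 10) / (2 * real q))"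
    unfolding sum by linarith
  also have "\<dots> \<le> (\<Sum>k=1..n. ((\<Prod>j<k. (real q + 1 - real j)) / real q ^ k) * (1 - (real k + 4) / real q))"
    by (rule sum_mono) (rule term_ge)
  finally show ?thesis .
qed

theorem corollary3p8:
  fixes q d :: nat
  assumes "q = CARD('a::{field,finite})"
  shows "average (\<lambda>r. real (card (periodic_points (rat_map r))))
           (rat_funs_of_degree d :: 'a rat_fun set)
         \<ge> (\<Sum>k=1..min d q. ((\<Prod>j<k. (real q + 1 - real j)) / real q ^ k) * (1 - (real k + 4) / real q))
       \<and> average (\<lambda>r. real (card (periodic_points (rat_map r))))
           (rat_funs_of_degree d :: 'a rat_fun set)
         \<ge> 5 / 6 * real_of_int (min (int d) \<lfloor>sqrt (real q)\<rfloor>) - 3"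
    (is "?S \<le> ?A \<and> ?B \<le> ?A")
proof
  have nonneg: "0 \<le> ?A" by (simp add: average_def sum_nonneg)
  \<comment> \<open>For \<open>d = 0\<close> the sum is empty.\<close>
  show "?S \<le> ?A"
    using average_periodic_points_ge[OF assms, of d "min d q"] nonneg by (cases "d = 0") auto
  define n where "n = nat (min (int d) \<lfloor>sqrt (real q)\<rfloor>)"
  have n: "int n = min (int d) \<lfloor>sqrt (real q)\<rfloor>" by (simp add: n_def)
  show "?B \<le> ?A"
  proof (cases "4 \<le> n")
    case True
    have "real n \<le> sqrt (real q)" using n by linarith
    then have "real n ^ 2 \<le> real q" using power_mono[of "real n" "sqrt (real q)" 2] by simp
    then have nq: "n ^ 2 \<le> q" by (simp flip: of_nat_power)
    then have "n \<le> min d q" using n self_le_power[of n 2] True by simp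
    then have "(\<Sum>k=1..n. ((\<Prod>j<k. (real q + 1 - real j)) / real q ^ k) * (1 - (real k + 4) / real q)) \<le> ?A"
      using True by (intro average_periodic_points_ge[OF assms]) auto
    then show ?thesis using lower_bound_5_6[OF True nq] by (simp flip: n)
  next
    \<comment> \<open>For n \<le> 3 the bound is at most 5 / 2 - 3 < 0.\<close>
    case False
    then show ?thesis using nonneg by (simp flip: n)
  qed
qed

end
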